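(* The sets $\mathrm{MARS}_m$, $m\in\mathbb{N}$, form an increasing sequence of open subsets of $\mathbb{C}$; that is, each $\mathrm{MARS}_m$ is open and $\mathrm{MARS}_m\subseteq\mathrm{MARS}_{m+1}$ for all $m\in\mathbb{N}$.
   Context: $\mathbb{N}=\{1,2,\dots\}$. For $m\in\mathbb{N}$ and $a\in\mathbb{C}$, $\mathcal{M}_m(a)\in\mathbb{C}^{m\times m}$ is the matrix whose $i$-th row, for $1\le i\le m-1$, has entry $1$ in column $i+1$ and zeros elsewhere, and whose last row has all entries equal to $\frac{a}{m}$. $\sigma(\cdot)$ denotes the spectrum and $B_1(0)=\{z\in\mathbb{C}:|z|<1\}$. $\mathrm{MARS}_m:=\{a\in\mathbb{C}:\sigma(\mathcal{M}_m(a))\subseteq B_1(0)\}$. *)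

theory Defs
  imports
    "HOL-Analysis.Elementary_Metric_Spaces"
    "Jordan_Normal_Form.Spectral_Radius"
begin

text \<open>Matrix indices are zero-based, so the last row is \<open>i = m - 1\<close>. For \<open>m = 1\<close> the only
  row is the last one and the matrix is \<open>(a)\<close>. The value at \<open>m = 0\<close> is junk.\<close>

definition mars_matrix :: "nat \<Rightarrow> complex \<Rightarrow> complex mat" where
  "mars_matrix m a =
     mat m m (\<lambda>(i, j). if i = m - 1 then a / of_nat m else if j = i + 1 then 1 else 0)"

definition MARS :: "nat \<Rightarrow> complex set" where
  "MARS m = {a. spectrum (mars_matrix m a) \<subseteq> ball 0 1}"

end

theory Submission
  imports Defs "HOL-Complex_Analysis.Conformal_Mappings"
begin

text \<open>
  Put \<open>F\<^sub>m(w) = (w + \<dots> + w\<^sup>m) / m\<close>. Inverting the eigenvalues, \<open>a\<close> lies outside \<open>MARS m\<close> iff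
  \<open>a F\<^sub>m(w) = 1\<close> for some \<open>w\<close> in the closed unit disc; compactness of the disc gives openness.

  For the inclusion, suppose that \<open>a\<close> is in \<open>MARS m\<close> but not in \<open>MARS (m + 1)\<close>. By the open mapping
  theorem, a point of the disc where \<open>a F\<^sub>m\<^sub>+\<^sub>1\<close> has the largest real value lies on the unit circle,
  so \<open>c a F\<^sub>m\<^sub>+\<^sub>1(w) = 1\<close> with \<open>0 < c \<le> 1\<close> and \<open>\<bar>w\<bar> = 1\<close>. Explicitly,
  \<open>F\<^sub>m(e\<^sup>2\<^sup>i\<^sup>x) = e\<^sup>i\<^sup>(\<^sup>m\<^sup>+\<^sup>1\<^sup>)\<^sup>x sin (m x) / (m sin x)\<close>, and comparing the outer arcs of the two curves
  (concavity of \<open>x \<mapsto> cot (t / x)\<close>) yields \<open>\<bar>v\<bar> = 1\<close> and \<open>k \<ge> 1\<close> with \<open>F\<^sub>m(v) = k F\<^sub>m\<^sub>+\<^sub>1(w)\<close>.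
  So \<open>c' a F\<^sub>m(v) = 1\<close> with \<open>0 < c' \<le> 1\<close>. This contradicts \<open>a \<in> MARS m\<close>: the polynomial
  \<open>Q = 1 - a F\<^sub>m\<close> has no root in the closed disc, hence \<open>Re (v Q'(v) / Q(v)) \<le> m / 2\<close>, whereas
  \<open>Re (v F\<^sub>m'(v) / F\<^sub>m(v)) = (m + 1) / 2\<close> on the unit circle makes it \<open>(m + 1) / (2 (1 - c'))\<close>.
\<close>

section \<open>The averaged power polynomial\<close>

text \<open>Encoded as a polynomial because the logarithmic derivative estimates use degree, roots
  and \<open>pderiv\<close>.\<close>

definition power_avg :: "nat \<Rightarrow> complex poly" where
  "power_avg m = Polynomial.smult (1 / of_nat m) (\<Sum>k=1..m. Polynomial.monom 1 k)"

lemma poly_power_avg: "poly (power_avg m) w = (\<Sum>k=1..m. w ^ k) / of_nat m"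
  by (simp add: power_avg_def poly_sum poly_monom)

lemma poly_power_avg_0 [simp]: "poly (power_avg m) 0 = 0"
  by (simp add: poly_power_avg power_0_left)

lemma poly_power_avg_1 [simp]: "m \<ge> 1 \<Longrightarrow> poly (power_avg m) 1 = 1"
  by (simp add: poly_power_avg)

lemma poly_power_avg_cnj: "poly (power_avg m) (cnj w) = cnj (poly (power_avg m) w)"
  by (simp add: poly_power_avg)

lemma degree_power_avg_le: "Polynomial.degree (power_avg m) \<le> m"
proof -
  have "Polynomial.degree (\<Sum>k=1..m. Polynomial.monom (1 :: complex) k) \<le> m"
    by (rule degree_sum_le) (simp_all add: degree_monom_eq)
  then show ?thesis
    unfolding power_avg_def by (rule order_trans[OF degree_smult_le])
qed

lemma mult_poly_pderiv_power_avg: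
  "w * poly (pderiv (power_avg m)) w = (\<Sum>k=1..m. of_nat k * w ^ k) / of_nat m"
proof -
  have *: "w * (of_nat k * w ^ (k - Suc 0)) = of_nat k * w ^ k" for k :: nat
    by (cases k) auto
  show ?thesis
    by (simp add: * power_avg_def pderiv_smult pderiv_sum pderiv_monom poly_sum poly_monom
        sum_distrib_left sum_divide_distrib)
qed

section \<open>Spectrum of the matrix and openness\<close>

text \<open>The shift rows force an eigenvector to be a multiple of
  \<open>(1, z, ..., z ^ (m - 1))\<close>; the last row then gives the equation.\<close>

lemma eigenvalue_mars_matrix_iff:
  assumes "m \<ge> 1"
  shows "eigenvalue (mars_matrix m a) z \<longleftrightarrow> z ^ m = a / of_nat m * (\<Sum>k<m. z ^ k)"
proof -
  have dim: "dim_row (mars_matrix m a) = m" "dim_col (mars_matrix m a) = m"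
    by (simp_all add: mars_matrix_def)
  have pow_m: "z * z ^ (m - 1) = z ^ m" using assms by (simp flip: power_Suc)
  have row: "vec_index (mars_matrix m a *\<^sub>v v) i =
      (if i = m - 1 then a / of_nat m * (\<Sum>j<m. vec_index v j) else vec_index v (i + 1))"
    if "v \<in> carrier_vec m" "i < m" for v i
  proof (cases "i = m - 1")
    case True
    then show ?thesis using that
      by (simp add: mars_matrix_def scalar_prod_def sum_distrib_left atLeast0LessThan)
  next
    case False
    then have "i + 1 < m" using that by simp
    then show ?thesis using that False
      by (simp add: mars_matrix_def scalar_prod_def if_distrib[of "\<lambda>x. x * _"] sum.If_cases
          cong: if_cong)
  qed
  show ?thesis
  proof
    assume "eigenvalue (mars_matrix m a) z"
    then obtain v where v: "v \<in> carrier_vec m" "v \<noteq> 0\<^sub>v m" "mars_matrix m a *\<^sub>v v = z \<cdot>\<^sub>v v"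
      unfolding eigenvalue_def eigenvector_def dim by blast
    have eq: "vec_index (mars_matrix m a *\<^sub>v v) i = z * vec_index v i" if "i < m" for i
      using v that by simp
    have geom: "vec_index v i = z ^ i * vec_index v 0" if "i < m" for i
      using that
    proof (induction i)
      case (Suc i)
      then have "i < m" "i \<noteq> m - 1" by auto
      then show ?case using Suc eq[of i] row[OF v(1), of i] by simp
    qed simp
    have nz: "vec_index v 0 \<noteq> 0"
    proof
      assume "vec_index v 0 = 0"
      then have "v = 0\<^sub>v m" using v(1) geom by (intro eq_vecI) auto
      with v(2) show False by simp
    qed
    have "a / of_nat m * (\<Sum>j<m. vec_index v j) = z * vec_index v (m - 1)"
      using eq[of "m - 1"] row[OF v(1), of "m - 1"] assms by simp
    also have "\<dots> = z ^ m * vec_index v 0"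
      using geom[of "m - 1"] assms by (simp flip: pow_m)
    also have "(\<Sum>j<m. vec_index v j) = (\<Sum>k<m. z ^ k) * vec_index v 0"
      unfolding sum_distrib_right by (intro sum.cong refl geom) simp
    finally have "(z ^ m - a / of_nat m * (\<Sum>k<m. z ^ k)) * vec_index v 0 = 0"
      by (simp add: algebra_simps)
    then show "z ^ m = a / of_nat m * (\<Sum>k<m. z ^ k)" using nz by simp
  next
    assume z: "z ^ m = a / of_nat m * (\<Sum>k<m. z ^ k)"
    define v where "v = Matrix.vec m (\<lambda>i. z ^ i)"
    have v: "v \<in> carrier_vec m" by (simp add: v_def)
    \<comment> \<open>Entry 0 is \<open>z ^ 0 = 1\<close>, also when \<open>z = 0\<close>.\<close>
    have "vec_index v 0 \<noteq> vec_index (0\<^sub>v m) 0" using assms by (simp add: v_def)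
    then have "v \<noteq> 0\<^sub>v m" by metis
    moreover have "mars_matrix m a *\<^sub>v v = z \<cdot>\<^sub>v v"
    proof (rule eq_vecI)
      fix i assume "i < dim_vec (z \<cdot>\<^sub>v v)"
      then have i: "i < m" using v by simp
      have "(\<Sum>j<m. vec_index v j) = (\<Sum>k<m. z ^ k)" by (simp add: v_def)
      then show "vec_index (mars_matrix m a *\<^sub>v v) i = vec_index (z \<cdot>\<^sub>v v) i"
        using row[OF v i] z i pow_m by (auto simp: v_def)
    qed (simp add: dim v_def)
    ultimately show "eigenvalue (mars_matrix m a) z"
      unfolding eigenvalue_def eigenvector_def dim using v by blast
  qed
qed

text \<open>Substitute \<open>z = inverse w\<close> in the eigenvalue equation. The excluded points
  are harmless: \<open>z = 0\<close> lies in the open disc, and \<open>w = 0\<close> never solves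
  the equation.\<close>

lemma MARS_iff:
  assumes "m \<ge> 1"
  shows "a \<in> MARS m \<longleftrightarrow> (\<forall>w\<in>cball 0 1. a * poly (power_avg m) w \<noteq> 1)"
proof -
  have ev: "eigenvalue (mars_matrix m a) (inverse w) \<longleftrightarrow> a * poly (power_avg m) w = 1"
    if "w \<noteq> 0" for w
  proof -
    have "(\<Sum>k=1..m. w ^ k) = w ^ m * (\<Sum>k<m. inverse w ^ k)"
      unfolding sum_distrib_left
      by (rule sum.reindex_bij_witness[of _ "\<lambda>k. m - k" "\<lambda>k. m - k"])
        (use that in \<open>auto simp: power_inverse field_simps simp flip: power_add\<close>)
    then show ?thesis
      using that assms
      by (auto simp: eigenvalue_mars_matrix_iff poly_power_avg field_simps)
  qed
  show ?thesis
  proof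
    assume a: "a \<in> MARS m"
    show "\<forall>w\<in>cball 0 1. a * poly (power_avg m) w \<noteq> 1"
    proof (intro ballI notI)
      fix w assume w: "w \<in> cball 0 1" "a * poly (power_avg m) w = 1"
      then have "w \<noteq> 0" by auto
      then have "eigenvalue (mars_matrix m a) (inverse w)" using w ev by simp
      then have "inverse w \<in> ball 0 1" using a unfolding MARS_def spectrum_def by blast
      then show False
        using w \<open>w \<noteq> 0\<close> by (auto simp: norm_inverse inverse_less_1_iff)
    qed
  next
    assume R: "\<forall>w\<in>cball 0 1. a * poly (power_avg m) w \<noteq> 1"
    have "norm z < 1" if "eigenvalue (mars_matrix m a) z" for z
    proof (rule ccontr)
      assume n: "\<not> norm z < 1"
      then have "z \<noteq> 0" by auto
      moreover have "inverse z \<in> cball 0 1"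
        using n \<open>z \<noteq> 0\<close> by (auto simp: norm_inverse inverse_le_1_iff)
      ultimately show False using ev[of "inverse z"] R that by auto
    qed
    then show "a \<in> MARS m" by (auto simp: MARS_def spectrum_def)
  qed
qed

lemma open_MARS:
  assumes "m \<ge> 1"
  shows "open (MARS m)"
proof -
  have "closed {x :: complex \<times> complex. snd x * poly (power_avg m) (fst x) = 1}"
    by (intro closed_Collect_eq continuous_intros)
  then have "closed {a. \<exists>w. w \<in> cball 0 1 \<and>
      (w, a) \<in> {x. snd x * poly (power_avg m) (fst x) = 1}}"
    by (intro closed_compact_projection) auto
  moreover have "{a. \<exists>w. w \<in> cball 0 1 \<and>
      (w, a) \<in> {x. snd x * poly (power_avg m) (fst x) = 1}} = - MARS m"
    by (simp add: set_eq_iff MARS_iff[OF assms] Bex_def)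
  ultimately show ?thesis by (simp add: closed_def)
qed

section \<open>Moving a root to the unit circle\<close>

lemma not_MARS_imp_scaled_unit_root:
  assumes m: "m \<ge> 1" and a: "a \<notin> MARS m"
  obtains c w where "0 < c" "c \<le> 1" "norm w = 1" "of_real c * a * poly (power_avg m) w = 1"
proof -
  define F where "F w = a * poly (power_avg m) w" for w
  \<comment> \<open>The reciprocal of the maximum of \<open>Re (F w)\<close> over \<open>K\<close>
    becomes \<open>c\<close>; the bound 1 in \<open>K\<close> gives
    \<open>c \<le> 1\<close>.\<close>
  define K where "K = {w \<in> cball 0 1. Im (F w) = 0 \<and> Re (F w) \<ge> 1}"
  obtain w0 where "w0 \<in> cball 0 1" "F w0 = 1"
    using a MARS_iff[OF m] by (auto simp: F_def)
  then have w0: "w0 \<in> K" by (simp add: K_def)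
  then have a0: "a \<noteq> 0" by (auto simp: K_def F_def)
  have cF: "continuous_on UNIV F" unfolding F_def by (intro continuous_intros)
  have "K = cball 0 1 \<inter> {w. Im (F w) = 0 \<and> Re (F w) \<ge> 1}" by (auto simp: K_def)
  moreover have "closed {w. Im (F w) = 0 \<and> Re (F w) \<ge> 1}"
    by (intro closed_Collect_conj closed_Collect_eq closed_Collect_le continuous_intros cF)
  ultimately have "compact K" by (simp add: compact_Int_closed)
  moreover have "continuous_on K (\<lambda>w. Re (F w))"
    by (intro continuous_intros continuous_on_subset[OF cF]) auto
  ultimately obtain w where w: "w \<in> K" and max: "\<And>y. y \<in> K \<Longrightarrow> Re (F y) \<le> Re (F w)"
    using continuous_attains_sup[of K "\<lambda>w. Re (F w)"] w0 by blast
  have "norm w = 1"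
  proof (rule ccontr)
    assume "norm w \<noteq> 1"
    with w have wb: "w \<in> ball 0 1" by (simp add: K_def)
    have "\<not> F constant_on UNIV"
    proof
      assume "F constant_on UNIV"
      then have "F 0 = F 1" by (metis constant_on_def UNIV_I)
      with a0 m show False by (simp add: F_def)
    qed
    moreover have "F holomorphic_on UNIV" unfolding F_def
      by (auto simp: holomorphic_on_def field_differentiable_def
          intro!: derivative_eq_intros poly_DERIV)
    ultimately have "open (F ` ball 0 1)"
      by (intro open_mapping_thm[of F UNIV]) auto
    then obtain e where e: "e > 0" "ball (F w) e \<subseteq> F ` ball 0 1"
      using wb by (meson imageI openE)
    have "F w + of_real (e / 2) \<in> ball (F w) e" using e by (simp add: dist_norm)
    then obtain y where y: "y \<in> ball 0 1" "F y = F w + of_real (e / 2)" using e by force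
    then have "y \<in> K" using w e by (simp add: K_def)
    from max[OF this] y e show False by simp
  qed
  moreover have "of_real (1 / Re (F w)) * F w = 1"
    using w by (auto simp: K_def complex_eq_iff)
  ultimately show thesis
    using that[of "1 / Re (F w)" w] w by (auto simp: K_def F_def mult.assoc)
qed

section \<open>Logarithmic derivatives on the unit circle\<close>

text \<open>Each root \<open>b\<close> contributes \<open>w / (w - b)\<close>, whose real part is at
  most 1/2 because \<open>(w + b) / (w - b)\<close> has nonpositive real part for
  \<open>norm w < norm b\<close>. Induction splits off one root at a time.\<close>

lemma Re_log_deriv_poly_le:
  assumes "\<And>b. poly p b = 0 \<Longrightarrow> norm b > 1" and w: "norm w = 1"
  shows "Re (w * poly (pderiv p) w / poly p w) \<le> Polynomial.degree p / 2"
  using assms(1)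
proof (induction "Polynomial.degree p" arbitrary: p)
  case 0
  then have "pderiv p = 0" by (simp add: pderiv_eq_0_iff)
  then show ?case by simp
next
  case (Suc n)
  then have "\<not> constant (poly p)" by (simp add: constant_degree)
  then obtain b where b: "poly p b = 0" 
    using Fundamental_Theorem_Algebra.fundamental_theorem_of_algebra[of p] by auto
  then have "[:- b, 1:] dvd p" using poly_eq_0_iff_dvd[of p b] by simp
  then obtain q where p: "p = [:- b, 1:] * q" by (rule dvdE)
  have q0: "q \<noteq> 0" using Suc.hyps(2) p by auto
  have deg: "Polynomial.degree p = Suc (Polynomial.degree q)" unfolding p using q0 by (subst degree_mult_eq) auto
  have nb: "norm b > 1" using Suc.prems b by blast
  then have wb: "w \<noteq> b" using w by auto
  have qw: "poly q w \<noteq> 0" using Suc.prems[of w] w p by auto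
  have "Re (w / (w - b)) \<le> 1 / 2"
  proof -
    have "w / (w - b) = (1 + (w + b) / (w - b)) / 2" using wb by (simp add: field_simps)
    then have half: "Re (w / (w - b)) = (1 + Re ((w + b) / (w - b))) / 2"
      by (simp only: Re_divide_numeral plus_complex.sel one_complex.sel)
    have "Re ((w + b) / (w - b)) = ((norm w)\<^sup>2 - (norm b)\<^sup>2) / (norm (w - b))\<^sup>2"
      unfolding Re_divide cmod_power2 by (simp add: power2_eq_square algebra_simps)
    also have "\<dots> \<le> 0" using nb w by (intro divide_nonpos_nonneg) simp_all
    finally show ?thesis unfolding half by simp
  qed
  moreover have "Re (w * poly (pderiv q) w / poly q w) \<le> Polynomial.degree q / 2"
    using Suc.hyps Suc.prems deg p by auto
  moreover have "w * poly (pderiv p) w / poly p w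
      = w / (w - b) + w * poly (pderiv q) w / poly q w"
    unfolding p pderiv_mult using wb qw by (simp add: pderiv_pCons field_simps)
  ultimately show ?case using deg by simp
qed

text \<open>On the unit circle conjugation inverts \<open>w\<close>, so multiplying by
  \<open>w ^ (m + 1)\<close> reverses the sums: \<open>F\<close> is fixed and \<open>G\<close>
  becomes \<open>(m + 1) F - G\<close>. Hence \<open>q = G / F\<close> satisfies
  \<open>q + cnj q = m + 1\<close>.\<close>

lemma Re_log_deriv_power_avg:
  assumes w: "norm w = 1" and "poly (power_avg m) w \<noteq> 0"
  shows "Re (w * poly (pderiv (power_avg m)) w / poly (power_avg m) w) = (m + 1) / 2"
proof -
  define F where "F = poly (power_avg m) w"
  define G where "G = w * poly (pderiv (power_avg m)) w"
  have F: "F \<noteq> 0" using assms by (simp add: F_def)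
  have w1: "w * cnj w = 1" using complex_norm_square[of w] w by simp
  have pw: "w ^ (m + 1) * cnj w ^ k = w ^ (m + 1 - k)" if "k \<le> m" for k
  proof -
    have "w ^ (m + 1) * cnj w ^ k = w ^ (m + 1 - k) * (w ^ k * cnj w ^ k)"
      using that by (simp flip: power_add mult.assoc)
    then show ?thesis by (simp add: w1 flip: power_mult_distrib)
  qed
  have "w ^ (m + 1) * cnj F = (\<Sum>k=1..m. w ^ (m + 1) * cnj w ^ k) / of_nat m"
    by (simp add: F_def poly_power_avg sum_distrib_left)
  also have "(\<Sum>k=1..m. w ^ (m + 1) * cnj w ^ k) = (\<Sum>k=1..m. w ^ (m + 1 - k))"
    by (intro sum.cong refl pw) auto
  also have "\<dots> = (\<Sum>k=1..m. w ^ k)"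
    by (rule sum.reindex_bij_witness[of _ "\<lambda>k. m + 1 - k" "\<lambda>k. m + 1 - k"]) auto
  finally have cF: "w ^ (m + 1) * cnj F = F" by (simp add: F_def poly_power_avg)
  have "w ^ (m + 1) * cnj G = (\<Sum>k=1..m. of_nat k * (w ^ (m + 1) * cnj w ^ k)) / of_nat m"
    by (simp add: G_def mult_poly_pderiv_power_avg sum_distrib_left mult_ac
        del: complex_cnj_mult) (simp add: mult_ac)
  also have "(\<Sum>k=1..m. of_nat k * (w ^ (m + 1) * cnj w ^ k))
      = (\<Sum>k=1..m. of_nat k * w ^ (m + 1 - k))"
    by (intro sum.cong refl arg_cong2[where f = "(*)"] pw) auto
  also have "\<dots> = (\<Sum>k=1..m. of_nat (m + 1 - k) * w ^ k)"
    by (rule sum.reindex_bij_witness[of _ "\<lambda>k. m + 1 - k" "\<lambda>k. m + 1 - k"]) auto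
  also have "\<dots> = (\<Sum>k=1..m. of_nat (m + 1) * w ^ k - of_nat k * w ^ k)"
    by (intro sum.cong refl) (auto simp: of_nat_diff algebra_simps)
  finally have cG: "w ^ (m + 1) * cnj G = of_nat (m + 1) * F - G"
    by (simp add: F_def G_def poly_power_avg mult_poly_pderiv_power_avg sum_subtractf
        diff_divide_distrib flip: sum_distrib_left)
  define q where "q = G / F"
  have "w \<noteq> 0" using w by auto
  then have "cnj q = (w ^ (m + 1) * cnj G) / (w ^ (m + 1) * cnj F)" by (simp add: q_def)
  also have "\<dots> = of_nat (m + 1) - q"
    unfolding cF cG using F by (simp add: q_def diff_divide_distrib)
  finally have "Re (cnj q) = Re (of_nat (m + 1) - q)" by (rule arg_cong)
  then have "Re q = (real m + 1) / 2" by simp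
  then show ?thesis by (simp add: q_def F_def G_def)
qed

lemma no_unit_root_scaled:
  assumes m: "m \<ge> 1" and a: "a \<in> MARS m" and c: "0 < c" "c \<le> 1" and w: "norm w = 1"
  shows "of_real c * a * poly (power_avg m) w \<noteq> 1"
proof
  assume eq: "of_real c * a * poly (power_avg m) w = 1"
  define F where "F = poly (power_avg m) w"
  define G where "G = w * poly (pderiv (power_avg m)) w"
  define Q where "Q = 1 - Polynomial.smult a (power_avg m)"
  have "c \<noteq> 1" using eq MARS_iff[OF m, of a] a w by auto
  with c have c1: "c < 1" by simp
  have F: "F \<noteq> 0" using eq by (auto simp: F_def)
  have aF: "a = 1 / (of_real c * F)" using eq F c by (auto simp: F_def field_simps)
  have "poly Q b = 0 \<Longrightarrow> norm b > 1" for b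
    using a MARS_iff[OF m, of a] by (force simp: Q_def not_less[symmetric])
  from Re_log_deriv_poly_le[OF this w]
  have "Re (w * poly (pderiv Q) w / poly Q w) \<le> Polynomial.degree Q / 2" by simp
  also have "Polynomial.degree Q \<le> m" unfolding Q_def
    by (intro degree_diff_le order_trans[OF degree_smult_le] degree_power_avg_le) auto
  then have "Polynomial.degree Q / 2 \<le> m / 2" by simp
  finally have le: "Re (w * poly (pderiv Q) w / poly Q w) \<le> m / 2" .
  have "w * poly (pderiv Q) w = - a * G" "poly Q w = 1 - a * F"
    by (simp_all add: Q_def F_def G_def pderiv_diff pderiv_smult)
  \<comment> \<open>Since \<open>a * F = 1 / c\<close>, the denominator is
    \<open>- (1 - c) / c\<close>.\<close>
  moreover have "- a * G / (1 - a * F) = G / F / of_real (1 - c)"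
    unfolding aF using F c c1 by (simp add: field_simps)
  ultimately have "w * poly (pderiv Q) w / poly Q w = G / F / of_real (1 - c)" by simp
  then have "Re (w * poly (pderiv Q) w / poly Q w) = Re (G / F) / (1 - c)"
    by (simp only: Re_divide_of_real)
  also have "Re (G / F) = (m + 1) / 2"
    using Re_log_deriv_power_avg[OF w, of m] F unfolding F_def G_def by simp
  finally have eq_div: "Re (w * poly (pderiv Q) w / poly Q w) = (m + 1) / 2 / (1 - c)" .
  have "(m + 1) / 2 \<le> m / 2 * (1 - c)"
    using le c1 unfolding eq_div by (simp only: pos_divide_le_eq diff_gt_0_iff_gt)
  moreover have "m / 2 * (1 - c) \<le> m / 2 * 1" using c by (intro mult_left_mono) auto
  ultimately show False by simp
qed

section \<open>Real trigonometric inequalities\<close>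

text \<open>Concavity of the sine on \<open>[0, pi]\<close>: its secant slope on
  \<open>[0, x]\<close> is at least that on \<open>[x, y]\<close>.\<close>

lemma mult_sin_le_mult_sin:
  fixes x y :: real
  assumes "0 < x" "x \<le> y" "y \<le> pi"
  shows "x * sin y \<le> y * sin x"
proof (cases "x = y")
  case False
  with assms have "x < y" by simp
  obtain u where u: "0 < u" "u < x" "sin x - sin 0 = (x - 0) * cos u"
    using MVT2[of 0 x sin cos] assms by auto
  obtain v where v: "x < v" "v < y" "sin y - sin x = (y - x) * cos v"
    using MVT2[of x y sin cos] \<open>x < y\<close> by auto
  have "cos v \<le> cos u" using u v assms by (intro cos_monotone_0_pi_le) auto
  then have "x * ((y - x) * cos v) \<le> x * ((y - x) * cos u)"
    using assms by (intro mult_left_mono) auto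
  then have "x * (sin y - sin x) \<le> (y - x) * sin x"
    using u(3) v(3) by (simp add: mult_ac)
  then show ?thesis by (simp add: algebra_simps)
qed simp

text \<open>The function \<open>x \<mapsto> cot (t / x)\<close> is concave, since its derivative
  \<open>(s / sin s)\<^sup>2 / t\<close> increases with \<open>s = t / x\<close>; the claim compares its secant slopes on
  \<open>[1, m + 1]\<close> and \<open>[m + 1, m + 2]\<close>.\<close>

lemma cot_div_secant:
  fixes t :: real
  assumes t: "0 < t" "t < pi" and m: "m \<ge> 1"
  shows "real m * cot (t / (m + 2)) + cot t \<le> (m + 1) * cot (t / (m + 1))"
proof -
  define h where "h x = cot (t / x)" for x
  define h' where "h' x = (t / x / sin (t / x))\<^sup>2 / t" for x
  have sin_pos: "sin (t / x) > 0" if "x \<ge> 1" for x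
  proof -
    have "t / x \<le> t" using that t by (simp add: divide_le_eq)
    then show ?thesis using that t by (intro sin_gt_zero) auto
  qed
  have der: "DERIV h x :> h' x" if "x \<ge> 1" for x
  proof -
    have "((\<lambda>x. t / x) has_real_derivative - t / x\<^sup>2) (at x)"
      using that by (auto intro!: derivative_eq_intros simp: power2_eq_square)
    moreover have "sin (t / x) \<noteq> 0" using sin_pos[OF that] by simp
    ultimately have "((\<lambda>x. cot (t / x)) has_real_derivative
        - inverse ((sin (t / x))\<^sup>2) * (- t / x\<^sup>2)) (at x)"
      using DERIV_chain2[OF DERIV_cot] by blast
    then show ?thesis
      using t by (simp add: h_def [abs_def] h'_def power2_eq_square field_simps)
  qed
  obtain u :: real where u: "1 < u" "u < m + 1" "h (m + 1) - h 1 = (m + 1 - 1) * h' u"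
    using MVT2[of 1 "real m + 1" h h'] der m by (auto simp: add_ac)
  obtain v :: real where v: "m + 1 < v" "v < m + 2" "h (m + 2) - h (m + 1) = (m + 2 - (m + 1)) * h' v"
    using MVT2[of "real m + 1" "real m + 2" h h'] der m by (force simp: add.commute)
  have "t / v * sin (t / u) \<le> t / u * sin (t / v)"
    using t u v by (intro mult_sin_le_mult_sin) (auto simp: field_simps intro: order_trans[of _ "u * t"])
  then have "t / v / sin (t / v) \<le> t / u / sin (t / u)"
    using sin_pos[of u] sin_pos[of v] u v by (simp add: pos_divide_le_eq pos_le_divide_eq mult_ac)
  then have "h' v \<le> h' u"
    unfolding h'_def using t u v sin_pos[of v] by (intro divide_right_mono power_mono) auto
  then have "m * (h (m + 2) - h (m + 1)) \<le> h (m + 1) - h 1"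
    unfolding u(3) v(3) by (simp add: mult_left_mono)
  then show ?thesis by (simp add: h_def algebra_simps)
qed

text \<open>Up to normalisation, the two sides are the moduli of the points of argument \<open>t\<close> on the outer
  arcs of the images of the unit circle under \<open>power_avg (m + 1)\<close> and \<open>power_avg m\<close>.\<close>

lemma sin_ratio_le:
  fixes t :: real and m :: nat
  assumes t: "0 < t" "t \<le> pi" and m: "m \<ge> 1"
  defines "s \<equiv> t / (m + 2)" and "r \<equiv> t / (m + 1)"
  shows "sin (t - s) / ((m + 1) * sin s) \<le> sin (t - r) / (m * sin r)"
proof -
  have s: "0 < s" "s < pi"
  proof -
    have "s \<le> t / 2" unfolding s_def using t by (intro divide_left_mono) auto
    then show "s < pi" using t by linarith
    show "0 < s" using t by (simp add: s_def)
  qed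
  have r: "0 < r" "r < pi"
  proof -
    have "r \<le> t / 2" unfolding r_def using t m by (intro divide_left_mono) auto
    then show "r < pi" using t by linarith
    show "0 < r" using t by (simp add: r_def)
  qed
  note pos = sin_gt_zero[OF s] sin_gt_zero[OF r]
  show ?thesis
  proof (cases "t = pi")
    case True
    have "sin x / (n * sin x) = 1 / n" if "sin x > 0" for x n :: real
      using that by simp
    then show ?thesis using pos m True by (simp add: frac_le)
  next
    case False
    with t have t': "t < pi" by simp
    have st: "sin t > 0" using t t' by (simp add: sin_gt_zero)
    have cot: "sin (t - x) / sin x = sin t * cot x - cos t" if "sin x > 0" for x
      using that by (simp add: sin_diff cot_def field_simps)
    have "sin t * (m * cot s + cot t) \<le> sin t * ((m + 1) * cot r)"
      using cot_div_secant[OF t(1) t' m] st by (intro mult_left_mono) (auto simp: s_def r_def add_ac)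
    \<comment> \<open>Here \<open>sin t * cot t = cos t\<close>, and \<open>(m + 1) * cos t\<close>
      is subtracted from both sides.\<close>
    then have "m * (sin t * cot s - cos t) \<le> (m + 1) * (sin t * cot r - cos t)"
      using st by (simp add: cot_def algebra_simps)
    then have "m * (sin (t - s) / sin s) \<le> (m + 1) * (sin (t - r) / sin r)"
      by (simp only: cot pos)
    moreover have "A / (m + 1) \<le> B / m" if "m * A \<le> (m + 1) * B" for A B :: real
      using that m by (simp add: field_simps)
    ultimately have "sin (t - s) / sin s / (m + 1) \<le> sin (t - r) / sin r / m" by blast
    then show ?thesis by (simp add: mult.commute)
  qed
qed

section \<open>Comparing the images of the unit circle\<close>

text \<open>The half-angle form of the geometric sum, kept free of division so that it also covers
  \<open>sin x = 0\<close> and \<open>m = 0\<close>.\<close>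

lemma poly_power_avg_cis:
  "of_real (m * sin x) * poly (power_avg m) (cis (2 * x)) = cis ((m + 1) * x) * of_real (sin (m * x))"
proof -
  have "of_real (sin x) * (\<Sum>k=1..m. cis (2 * x) ^ k) = cis ((m + 1) * x) * of_real (sin (m * x))"
  proof (induction m)
    case (Suc m)
    define y where "y = (m + 1) * x"
    have mx: "m * x = y - x" by (simp add: y_def algebra_simps)
    have pw: "cis (2 * x) ^ Suc m = cis y * cis y"
      unfolding Complex.DeMoivre cis_mult by (rule arg_cong[where f = cis]) (simp add: y_def algebra_simps)
    have "of_real (sin x) * (\<Sum>k=1..Suc m. cis (2 * x) ^ k)
        = cis y * of_real (sin (y - x)) + of_real (sin x) * (cis y * cis y)"
      using Suc.IH unfolding mx pw[symmetric] y_def[symmetric] by (simp add: distrib_left)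
    also have "\<dots> = cis y * (of_real (sin (y - x)) + of_real (sin x) * cis y)"
      by (simp add: algebra_simps)
    also have "of_real (sin (y - x)) + of_real (sin x) * cis y = cis x * of_real (sin y)"
      by (simp add: complex_eq_iff sin_diff algebra_simps)
    also have "cis y * (cis x * of_real (sin y)) = cis (y + x) * of_real (sin y)"
      by (simp add: cis_mult flip: mult.assoc)
    also have "y + x = (Suc m + 1) * x" by (simp add: y_def algebra_simps)
    also have "y = Suc m * x" by (simp add: y_def)
    finally show ?case .
  qed simp
  then show ?thesis by (cases "m = 0") (simp_all add: poly_power_avg add.commute)
qed

text \<open>Among the points of argument \<open>t\<close> on the image of the unit circle under \<open>power_avg (m + 1)\<close>,
  the one on the first arc, where \<open>x = \<bar>t\<bar> / (m + 2)\<close>, has the largest modulus.\<close>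

lemma unit_value_dominated_upper:
  assumes m: "m \<ge> 1" and x: "0 < x" "x \<le> pi / 2"
    and nz: "poly (power_avg (m + 1)) (cis (2 * x)) \<noteq> 0"
  obtains v k where "norm v = 1" "k \<ge> 1"
    "poly (power_avg m) v = of_real k * poly (power_avg (m + 1)) (cis (2 * x))"
proof -
  define Y where "Y = poly (power_avg (m + 1)) (cis (2 * x))"
  define t where "t = Arg Y"
  define u where "u = (m + 1) * sin x * norm Y"
  define T where "T = (m + 2) * x"
  define y where "y = sin ((m + 1) * x)"
  have Y: "Y \<noteq> 0" using nz by (simp add: Y_def)
  have Yt: "Y = of_real (norm Y) * cis t"
    using rcis_cmod_Arg[of Y] by (simp add: t_def rcis_def)
  have t: "- pi < t" "t \<le> pi" using Arg_bounded[of Y] by (auto simp: t_def)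
  have sx: "sin x > 0" using x by (intro sin_gt_zero) auto
  have u0: "u > 0" using sx Y by (simp add: u_def)
  have "of_real u * cis t = of_real ((m + 1) * sin x) * Y"
    by (subst Yt) (simp add: u_def mult_ac)
  also have "\<dots> = cis T * of_real y"
    using poly_power_avg_cis[of "m + 1" x] by (simp add: T_def y_def Y_def add_ac)
  finally have "of_real u * cis t * cis (- t) = of_real y * (cis T * cis (- t))" by simp
  then have "of_real u = of_real y * cis (T - t)" by (simp only: cis_mult mult.assoc) simp
  \<comment> \<open>Thus \<open>T\<close> and \<open>t\<close> agree modulo \<open>pi\<close>, and
    \<open>cos (T - t)\<close> records the sign of \<open>y\<close>.\<close>
  then have uy: "u = y * cos (T - t)" "y * sin (T - t) = 0"
    by (simp_all add: complex_eq_iff)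
  have y0: "y \<noteq> 0" using uy u0 by auto
  then have sTt: "sin (T - t) = 0" using uy by simp
  have "t - x = (m + 1) * x - (T - t)" by (simp add: T_def algebra_simps)
  then have "sin (t - x) = sin ((m + 1) * x) * cos (T - t) - cos ((m + 1) * x) * sin (T - t)"
    by (simp only: sin_diff)
  then have u_sin: "u = sin (t - x)" using uy(1) sTt by (simp add: y_def)
  define \<tau> where "\<tau> = \<bar>t\<bar>"
  have \<tau>: "0 \<le> \<tau>" "\<tau> \<le> pi" using t by (auto simp: \<tau>_def)
  \<comment> \<open>Reflecting a negative \<open>t\<close> can only increase the sine, as
    \<open>cos x \<ge> 0\<close>.\<close>
  have u_le: "u \<le> sin (\<tau> - x)"
  proof (cases "t \<ge> 0")
    case False
    then have "sin t \<le> 0" using sin_ge_zero[of "- t"] t by simp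
    moreover have "cos x \<ge> 0" using x by (intro cos_ge_zero) auto
    ultimately have "sin t * cos x \<le> - sin t * cos x" by (simp add: mult_nonpos_nonneg)
    then show ?thesis using False by (simp add: u_sin \<tau>_def sin_diff mult.commute)
  qed (simp add: u_sin \<tau>_def)
  have "\<tau> > x"
  proof (rule ccontr)
    assume "\<not> \<tau> > x"
    then have "sin (x - \<tau>) \<ge> 0" using x \<tau> by (intro sin_ge_zero) auto
    then show False using u_le u0 sin_minus[of "x - \<tau>"] by simp
  qed
  with x have \<tau>0: "\<tau> > 0" by simp
  \<comment> \<open>If \<open>T < \<tau>\<close>, then \<open>y > 0\<close>, so \<open>T\<close> and
    \<open>t\<close> agree modulo \<open>2 * pi\<close>; both are small enough to force
    \<open>T = t\<close>, a contradiction.\<close>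
  have "\<tau> \<le> T"
  proof (rule ccontr)
    assume "\<not> \<tau> \<le> T"
    then have T: "T < pi" using \<tau> by simp
    have T0: "T > 0" using x by (simp add: T_def)
    have "(m + 1) * x < T" using x by (simp add: T_def)
    then have "y > 0" unfolding y_def using T x by (intro sin_gt_zero) auto
    then have "cos (T - t) > 0" using uy(1) u0 by (simp add: zero_less_mult_iff)
    then have "cos (T - t) = 1" using sTt sin_zero_abs_cos_one[OF sTt] by simp
    then obtain n :: int where n: "T - t = n * 2 * pi" by (auto simp: cos_one_2pi_int)
    have "\<bar>T - t\<bar> < 2 * pi" using T T0 t by simp
    then have "\<bar>real_of_int n\<bar> * (2 * pi) < 1 * (2 * pi)" unfolding n by (simp add: abs_mult)
    then have "n = 0" by (subst (asm) mult_less_cancel_right) auto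
    with n T0 \<open>\<not> \<tau> \<le> T\<close> show False by (simp add: \<tau>_def)
  qed
  \<comment> \<open>\<open>s\<close> and \<open>r\<close> parametrise the points of argument
    \<open>\<tau>\<close> on the first arcs for \<open>m + 1\<close> and \<open>m\<close>.\<close>
  define s where "s = \<tau> / (m + 2)"
  define r where "r = \<tau> / (m + 1)"
  have sx_le: "s \<le> x" using \<open>\<tau> \<le> T\<close> by (simp add: s_def T_def field_simps)
  have s0: "s > 0" using \<tau>0 by (simp add: s_def)
  have ss: "sin s > 0" using s0 sx_le x by (intro sin_gt_zero) auto
  have "r \<le> \<tau> / 2" unfolding r_def using \<tau>0 m by (intro divide_left_mono) auto
  then have "r < pi" using \<tau>0 \<tau> by linarith
  moreover have "r > 0" using \<tau>0 by (simp add: r_def)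
  ultimately have sr: "sin r > 0" by (intro sin_gt_zero)
  \<comment> \<open>This identity shows that \<open>sin (\<tau> - x) / sin x\<close> does not exceed
    its value at \<open>s \<le> x\<close>.\<close>
  have "sin (\<tau> - s) * sin x - sin (\<tau> - x) * sin s = sin \<tau> * sin (x - s)"
    by (simp add: sin_diff algebra_simps)
  also have "\<dots> \<ge> 0" using \<tau> sx_le s0 x by (intro mult_nonneg_nonneg sin_ge_zero) auto
  finally have "sin (\<tau> - x) / sin x \<le> sin (\<tau> - s) / sin s"
    using ss sx by (simp add: field_simps)
  moreover have "(m + 1) * norm Y \<le> sin (\<tau> - x) / sin x"
    using u_le sx by (simp add: u_def field_simps)
  ultimately have "norm Y * (m + 1) \<le> sin (\<tau> - s) / sin s" by (simp only: mult.commute)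
  then have "norm Y \<le> sin (\<tau> - s) / sin s / (m + 1)" by (subst pos_le_divide_eq) simp_all
  also have "\<dots> \<le> sin (\<tau> - r) / (m * sin r)"
    using sin_ratio_le[OF \<tau>0 \<tau>(2) m] by (simp add: s_def r_def mult.commute)
  finally have le: "norm Y \<le> sin (\<tau> - r) / (m * sin r)" .
  define R where "R = sin (\<tau> - r) / (m * sin r)"
  \<comment> \<open>Restoring the sign of \<open>t\<close> puts the comparison point on the ray of
    \<open>Y\<close>.\<close>
  define q where "q = sgn t * r"
  have "(real m + 1) * r = \<tau>" by (simp add: r_def add.commute)
  then have t_q: "t = (real m + 1) * q"
    using sgn_mult_abs[of t] by (simp add: q_def \<tau>_def mult.left_commute)
  have "\<tau> - r = m * r" by (simp add: r_def field_simps)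
  then have R: "R = sin (m * q) / (m * sin q)" and sq: "sin q \<noteq> 0"
    using \<tau>0 sr by (auto simp: R_def q_def sgn_if \<tau>_def)
  have "of_real (m * sin q) * poly (power_avg m) (cis (2 * q)) = cis t * of_real (sin (m * q))"
    unfolding t_q by (rule poly_power_avg_cis)
  then have "poly (power_avg m) (cis (2 * q)) = of_real R * cis t"
    using sq m by (simp add: R field_simps)
  also have "\<dots> = of_real (R / norm Y) * Y" using Y by (subst (2) Yt) simp
  finally have "poly (power_avg m) (cis (2 * q)) = of_real (R / norm Y) * Y" .
  moreover have "1 \<le> R / norm Y" using le Y unfolding R_def by (subst pos_le_divide_eq) simp_all
  ultimately show thesis using that[of "cis (2 * q)" "R / norm Y"] unfolding Y_def by simp
qed

text \<open>Conjugation carries the lower half circle to the upper one; at \<open>w = 1\<close> both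
  averages equal 1.\<close>

lemma unit_value_dominated:
  assumes m: "m \<ge> 1" and w: "norm w = 1" and nz: "poly (power_avg (m + 1)) w \<noteq> 0"
  obtains v k where "norm v = 1" "k \<ge> 1"
    "poly (power_avg m) v = of_real k * poly (power_avg (m + 1)) w"
proof -
  define x where "x = Arg w / 2"
  have wx: "w = cis (2 * x)" using rcis_cmod_Arg[of w] w by (simp add: x_def rcis_def)
  have x: "- (pi / 2) < x" "x \<le> pi / 2" using Arg_bounded[of w] by (auto simp: x_def)
  consider "x = 0" | "x > 0" | "x < 0" by linarith
  then show thesis
  proof cases
    case 1
    then show ?thesis using that[of 1 1] m wx by simp
  next
    case 2
    then show ?thesis using unit_value_dominated_upper[OF m _ x(2)] nz that unfolding wx by blast
  next
    case 3
    have c: "cis (2 * - x) = cnj w" by (simp add: wx cis_cnj)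
    obtain v k where v: "norm v = 1" "k \<ge> 1"
      "poly (power_avg m) v = of_real k * poly (power_avg (m + 1)) (cnj w)"
      using unit_value_dominated_upper[OF m, of "- x"] 3 x nz unfolding c poly_power_avg_cnj by auto
    then have "poly (power_avg m) (cnj v) = of_real k * poly (power_avg (m + 1)) w"
      by (simp add: poly_power_avg_cnj)
    then show ?thesis using that[of "cnj v" k] v by simp
  qed
qed

section \<open>The inclusion and the conclusion\<close>

lemma MARS_subset_Suc:
  assumes m: "m \<ge> 1"
  shows "MARS m \<subseteq> MARS (m + 1)"
proof
  fix a assume a: "a \<in> MARS m"
  show "a \<in> MARS (m + 1)"
  proof (rule ccontr)
    assume "a \<notin> MARS (m + 1)"
    then obtain c w where c: "0 < c" "c \<le> 1" "norm w = 1"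
      and w: "of_real c * a * poly (power_avg (m + 1)) w = 1"
      using not_MARS_imp_scaled_unit_root[of "m + 1" a] by auto
    then obtain v k where v: "norm v = 1" "k \<ge> 1"
      "poly (power_avg m) v = of_real k * poly (power_avg (m + 1)) w"
      using unit_value_dominated[OF m, of w] by force
    have "of_real (c / k) * a * poly (power_avg m) v
        = of_real c * a * poly (power_avg (m + 1)) w"
      using v by simp
    moreover have "0 < c / k" "c / k \<le> 1" using c v by (auto simp: divide_le_eq)
    ultimately show False using no_unit_root_scaled[OF m a _ _ v(1)] w by metis
  qed
qed

theorem theorem9p3:
  shows "\<forall>m\<ge>1. open (MARS m) \<and> MARS m \<subseteq> MARS (m + 1)"
  using open_MARS MARS_subset_Suc by blast

end
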